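(* There exists a mapping $f: \Gamma_0 \to \mathcal{G}$, computable in time polynomial in the size of its input graph, such that for every two connected graphs $G_1, G_2 \in \Gamma_0$ having the same number of nodes and the same number of edges, $G_1 \simeq G_2$ if and only if $f(G_1) \simeq f(G_2)$.
   Context: $\Gamma_0$ is the set of finite undirected graphs in which self-loops (edges $\{v,v\}$) are allowed; a self-loop counts as one edge. The class $\mathcal{G}\subset\Gamma_0$ consists of the graphs $G$ with $n$ nodes, $m$ edges and $s$ self-loops such that: (P1) $G$ is undirected, connected and not bipartite; (P2) $n$ is prime; (P3) $s < m$; (P4) $2m - s$ is not divisible by $2$; (P5) $2m-s$ is not divisible by $3$. $\simeq$ denotes graph isomorphism. *)

theory Defs
  imports "HOL-Computational_Algebra.Computational_Algebra" "HOL-Library.FuncSet"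
begin

section \<open>Finite undirected graphs with self-loops\<close>

text \<open>A self-loop at \<open>v\<close> is the edge \<open>{v, v} = {v}\<close>, a single element of \<open>edges\<close>.\<close>

datatype 'a ugraph = UGraph (verts: "'a set") (edges: "'a set set")

definition ugraph :: "'a ugraph \<Rightarrow> bool" where
  "ugraph G \<longleftrightarrow> finite (verts G) \<and> (\<forall>e\<in>edges G. \<exists>u\<in>verts G. \<exists>v\<in>verts G. e = {u, v})"

definition num_nodes :: "'a ugraph \<Rightarrow> nat" where
  "num_nodes G = card (verts G)"

definition num_edges :: "'a ugraph \<Rightarrow> nat" where
  "num_edges G = card (edges G)"

definition num_loops :: "'a ugraph \<Rightarrow> nat" where
  "num_loops G = card {v \<in> verts G. {v, v} \<in> edges G}"

definition connected_graph :: "'a ugraph \<Rightarrow> bool" where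
  "connected_graph G \<longleftrightarrow>
     (\<forall>u\<in>verts G. \<forall>v\<in>verts G. (u, v) \<in> {(x, y). {x, y} \<in> edges G}\<^sup>*)"

definition bipartite_graph :: "'a ugraph \<Rightarrow> bool" where
  "bipartite_graph G \<longleftrightarrow>
     (\<exists>A B. A \<union> B = verts G \<and> A \<inter> B = {} \<and> (\<forall>e\<in>edges G. \<exists>a\<in>A. \<exists>b\<in>B. e = {a, b}))"

definition graph_iso :: "'a ugraph \<Rightarrow> 'b ugraph \<Rightarrow> bool"  (infix "\<simeq>" 50) where
  "G \<simeq> H \<longleftrightarrow> (\<exists>\<pi>. bij_betw \<pi> (verts G) (verts H) \<and>
     (\<forall>u\<in>verts G. \<forall>v\<in>verts G. {u, v} \<in> edges G \<longleftrightarrow> {\<pi> u, \<pi> v} \<in> edges H))"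

text \<open>Vertices are natural numbers, so that graphs can be inputs and outputs of programs; the
  vertex set may be any finite set of naturals.\<close>

definition Gamma0 :: "nat ugraph set" where
  "Gamma0 = {G. ugraph G}"

definition class_G :: "nat ugraph set" where
  "class_G = {G \<in> Gamma0.
     connected_graph G \<and> \<not> bipartite_graph G \<and>
     prime (num_nodes G) \<and>
     num_loops G < num_edges G \<and>
     \<not> 2 dvd (2 * num_edges G - num_loops G) \<and>
     \<not> 3 dvd (2 * num_edges G - num_loops G)}"


section \<open>Polynomial-time computability\<close>

text \<open>
  The machine model is a random access machine in the style of Cook and Reckhow, presented as a
  structured programming language. It has registers and an indirectly addressed memory, both
  holding natural numbers, and an append-only output. Each executed instruction and each evaluated
  test costs one unit. The only arithmetic is addition and truncated subtraction, with no
  multiplication or shifts, so in \<open>t\<close> steps the bit length of any word grows by at most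
  \<open>t\<close> plus a constant. Unit cost is therefore polynomially related to logarithmic cost
  and to Turing machine time.
\<close>

datatype com =
    Skip
  | Const nat nat           \<comment> \<open>\<open>Const x k\<close>: \<open>R[x] := k\<close>\<close>
  | Add nat nat nat         \<comment> \<open>\<open>Add x y z\<close>: \<open>R[x] := R[y] + R[z]\<close>\<close>
  | Sub nat nat nat         \<comment> \<open>\<open>Sub x y z\<close>: \<open>R[x] := R[y] - R[z]\<close> (truncated)\<close>
  | Load nat nat            \<comment> \<open>\<open>Load x y\<close>: \<open>R[x] := M[R[y]]\<close>\<close>
  | Store nat nat           \<comment> \<open>\<open>Store x y\<close>: \<open>M[R[x]] := R[y]\<close>\<close>
  | Print nat               \<comment> \<open>\<open>Print x\<close>: append \<open>R[x]\<close> to the output\<close>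
  | Seq com com
  | IfLess nat nat com com  \<comment> \<open>\<open>IfLess x y c d\<close>: if \<open>R[x] < R[y]\<close> then \<open>c\<close> else \<open>d\<close>\<close>
  | WhileLess nat nat com   \<comment> \<open>\<open>WhileLess x y c\<close>: while \<open>R[x] < R[y]\<close> do \<open>c\<close>\<close>

record state =
  reg :: "nat \<Rightarrow> nat"
  mem :: "nat \<Rightarrow> nat"
  out :: "nat list"

text \<open>\<open>exec c s t s'\<close>: started in \<open>s\<close>, program \<open>c\<close> halts in \<open>s'\<close> after exactly \<open>t\<close> steps.\<close>

inductive exec :: "com \<Rightarrow> state \<Rightarrow> nat \<Rightarrow> state \<Rightarrow> bool" where
  Skip:  "exec Skip s 1 s"
| Const: "exec (Const x k) s 1 (s\<lparr>reg := (reg s)(x := k)\<rparr>)"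
| Add:   "exec (Add x y z) s 1 (s\<lparr>reg := (reg s)(x := reg s y + reg s z)\<rparr>)"
| Sub:   "exec (Sub x y z) s 1 (s\<lparr>reg := (reg s)(x := reg s y - reg s z)\<rparr>)"
| Load:  "exec (Load x y) s 1 (s\<lparr>reg := (reg s)(x := mem s (reg s y))\<rparr>)"
| Store: "exec (Store x y) s 1 (s\<lparr>mem := (mem s)(reg s x := reg s y)\<rparr>)"
| Print: "exec (Print x) s 1 (s\<lparr>out := out s @ [reg s x]\<rparr>)"
| Seq:   "exec c s t s' \<Longrightarrow> exec d s' t' s'' \<Longrightarrow> exec (Seq c d) s (t + t') s''"
| IfTrue:  "reg s x < reg s y \<Longrightarrow> exec c s t s' \<Longrightarrow> exec (IfLess x y c d) s (1 + t) s'"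
| IfFalse: "\<not> reg s x < reg s y \<Longrightarrow> exec d s t s' \<Longrightarrow> exec (IfLess x y c d) s (1 + t) s'"
| WhileFalse: "\<not> reg s x < reg s y \<Longrightarrow> exec (WhileLess x y c) s 1 s"
| WhileTrue:  "reg s x < reg s y \<Longrightarrow> exec c s t s' \<Longrightarrow> exec (WhileLess x y c) s' t' s''
    \<Longrightarrow> exec (WhileLess x y c) s (1 + t + t') s''"

lemma exec_deterministic:
  "exec c s t s' \<Longrightarrow> exec c s u s'' \<Longrightarrow> u = t \<and> s'' = s'"
proof (induction arbitrary: u s'' rule: exec.induct)
  case (Seq c s t s' d t' s'')
  from Seq.prems show ?case by cases (use Seq.IH in blast)
next
  case (WhileTrue s x y c t s' t' s'')
  from WhileTrue.prems show ?case by cases (use WhileTrue in blast)+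
qed (erule exec.cases; force)+

definition initial_state :: "nat list \<Rightarrow> state" where
  "initial_state xs =
     \<lparr>reg = (\<lambda>_. 0), mem = (\<lambda>i. if i < length xs then xs ! i else 0), out = []\<rparr>"

text \<open>A graph is encoded by its number of vertices, the increasing list of its vertices, and the
  rows of its adjacency matrix with respect to that ordering.\<close>

definition encode :: "nat ugraph \<Rightarrow> nat list" where
  "encode G = (let vs = sorted_list_of_set (verts G) in
     num_nodes G # vs @
     concat (map (\<lambda>u. map (\<lambda>v. if {u, v} \<in> edges G then 1 else 0) vs) vs))"

lemma encode_inject:
  assumes "ugraph G" "ugraph H" "encode G = encode H"
  shows "G = H"
proof -
  define row where "row K u = map (\<lambda>v. if {u, v} \<in> edges K then 1 else (0::nat))
    (sorted_list_of_set (verts K))" for K :: "nat ugraph" and u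
  have enc: "encode K = num_nodes K # sorted_list_of_set (verts K) @
      concat (map (row K) (sorted_list_of_set (verts K)))" for K
    by (simp add: encode_def row_def[abs_def] Let_def)
  have fin: "finite (verts G)" "finite (verts H)"
    using assms by (auto simp: ugraph_def)
  have vs: "sorted_list_of_set (verts G) = sorted_list_of_set (verts H)"
    and cc: "concat (map (row G) (sorted_list_of_set (verts G)))
           = concat (map (row H) (sorted_list_of_set (verts H)))"
    using assms(3) by (auto simp: enc num_nodes_def)
  then have V: "verts G = verts H"
    using fin by (metis sorted_list_of_set.set_sorted_key_list_of_set)
  have "map (row G) (sorted_list_of_set (verts G)) = map (row H) (sorted_list_of_set (verts H))"
    by (rule concat_injective[OF cc]) (auto simp: vs row_def set_zip)
  then have row: "row G u = row H u" if "u \<in> verts G" for u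
    using that fin V by auto
  have adj: "{u, v} \<in> edges G \<longleftrightarrow> {u, v} \<in> edges H" if "u \<in> verts G" "v \<in> verts G" for u v
    using row[OF that(1)] that(2) fin V by (auto simp: row_def split: if_splits)
  have "edges G = edges H"
    using assms(1,2) adj V unfolding ugraph_def by (intro set_eqI) metis
  with V show ?thesis by (simp add: ugraph.expand)
qed

text \<open>The running time is bounded in the number of vertices plus the number of edges, which is
  polynomially related to the length of the encoding.\<close>

definition graph_size :: "'a ugraph \<Rightarrow> nat" where
  "graph_size G = num_nodes G + num_edges G"

definition poly_time_computable :: "(nat ugraph \<Rightarrow> nat ugraph) \<Rightarrow> bool" where
  "poly_time_computable f \<longleftrightarrow>
     (\<exists>(c :: com) (p :: nat poly). \<forall>G\<in>Gamma0. \<exists>t s.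
        exec c (initial_state (encode G)) t s \<and> out s = encode (f G) \<and>
        t \<le> poly p (graph_size G))"

end

theory Submission
  imports Defs
begin

text \<open>Given \<open>G\<close> with \<open>n\<close> vertices, add a hub adjacent to every vertex and to itself, together with
  otherwise isolated vertices, until the number \<open>N\<close> of vertices is prime. The looped hub makes the
  graph connected and not bipartite. Loops on some of the additional vertices compensate for the
  edges of \<open>G\<close>, so that \<open>2 m - s\<close> becomes \<open>3 N - 6 n - 4\<close>, which is coprime to \<open>6\<close> for odd \<open>N\<close>.
  The hub is the only dominating vertex, and if \<open>G\<close> is connected with at least two vertices, then
  its vertices are those with a neighbour other than the hub and themselves; hence \<open>G\<close> can be
  recovered up to isomorphism.

  Instead of Bertrand's postulate, a quadratic bound on the next prime suffices: \<open>k (2k choose k)\<close>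
  divides every common multiple of \<open>1, \<dots>, 2k\<close>, and if all primes up to \<open>2k\<close> are at most \<open>n\<close>, then
  there is a common multiple that is at most \<open>(2k)\<^sup>n\<close>.\<close>

section \<open>Primes in polynomially bounded intervals\<close>

text \<open>This is Leibniz's harmonic triangle: \<open>1 / ((m + 1) * (k + 1 choose m + 1))\<close>
  is the difference of \<open>1 / (m * (k choose m))\<close> and
  \<open>1 / (m * (k + 1 choose m))\<close>. Multiplied by \<open>d\<close>, both terms are integers
  by induction on \<open>m\<close>; for \<open>m = 1\<close> the quotient is
  \<open>d / n\<close>.\<close>

lemma times_binomial_dvd:
  fixes d :: nat
  assumes "1 \<le> m" "m \<le> n" and "\<And>i. 1 \<le> i \<Longrightarrow> i \<le> n \<Longrightarrow> i dvd d"
  shows "m * (n choose m) dvd d"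
proof -
  have "real d / (real m * real (n choose m)) \<in> \<int>"
    using assms
  proof (induction m arbitrary: n rule: dec_induct)
    case base
    have "real_of_int (int d) / real_of_int (int n) \<in> \<int>"
      using base by (subst of_int_div_of_int_in_Ints_iff) auto
    then show ?case by simp
  next
    case (step m)
    obtain k where n: "n = Suc k" using step by (cases n) auto
    define A where "A = real (k choose m)"
    define B where "B = real (Suc k choose m)"
    have le: "m \<le> k" using step n by simp
    have A: "A > 0" using le by (simp add: A_def)
    have B: "B > 0" using le by (simp add: B_def)
    have eB: "(real k + 1 - real m) * B = (real k + 1) * A"
    proof -
      have "real (Suc k - m) * B = real (Suc k) * A"
        using binomial_absorb_comp[of "Suc k" m] unfolding A_def B_def diff_Suc_1 by (metis of_nat_mult)
      then show ?thesis using le by (simp add: of_nat_diff algebra_simps)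
    qed
    have eC: "real (Suc m) * real (Suc k choose Suc m) = (real k + 1) * A"
      using arg_cong[OF Suc_times_binomial[of m k], of real] by (simp add: A_def algebra_simps)
    have "real m > 0" using step by simp
    then have "real d / ((real k + 1) * A) = real d / (real m * A) - real d / (real m * B)"
    proof -
      \<comment> \<open>Expanding the fraction by \<open>k + 1\<close> turns its numerator factor
        \<open>B - A\<close> into \<open>m * B\<close>, which then cancels.\<close>
      have *: "B * (real k + 1) - (real k + 1) * A = B * real m"
        using eB by (simp add: algebra_simps)
      have "real d / (real m * A) - real d / (real m * B) = real d * (B - A) / (real m * A * B)"
        using A B \<open>real m > 0\<close> by (simp add: field_simps)
      also have "\<dots> = (real k + 1) * (real d * (B - A)) / ((real k + 1) * (real m * A * B))"
        by (rule mult_divide_mult_cancel_left[symmetric]) linarith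
      also have "\<dots> = real d * ((real k + 1) * (B - A)) / (real m * A * B * (real k + 1))"
        by (simp only: ac_simps)
      also have "(real k + 1) * (B - A) = B * real m"
        using * by (simp add: algebra_simps)
      also have "real d * (B * real m) / (real m * A * B * (real k + 1))
          = (B * real m) * real d / ((B * real m) * ((real k + 1) * A))"
        by (simp only: ac_simps)
      also have "\<dots> = real d / ((real k + 1) * A)"
        using B \<open>real m > 0\<close> by (intro mult_divide_mult_cancel_left) simp
      finally show ?thesis by simp
    qed
    moreover have "real d / (real m * A) \<in> \<int>"
      unfolding A_def using step n le by (intro step.IH) auto
    moreover have "real d / (real m * B) \<in> \<int>"
      unfolding B_def using step n le by (intro step.IH) auto
    ultimately show ?case
      unfolding n eC by (metis Ints_diff)
  qed
  then have "real_of_int (int d) / real_of_int (int (m * (n choose m))) \<in> \<int>"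
    by simp
  then have "int (m * (n choose m)) dvd int d"
    using assms by (subst (asm) of_int_div_of_int_in_Ints_iff) auto
  then show ?thesis by (simp only: int_dvd_int_iff)
qed

text \<open>The multiple is the product, over the primes \<open>p \<le> n\<close>, of the largest
  power of \<open>p\<close> not exceeding \<open>N\<close>. Each factor is at most \<open>N\<close>,
  and there are at most \<open>n\<close> factors. Every prime power in some \<open>i \<le> N\<close>
  is itself at most \<open>N\<close>, so it divides the matching factor.\<close>

lemma common_multiple_le_power:
  fixes n N :: nat
  assumes no: "\<And>p. prime p \<Longrightarrow> p \<le> N \<Longrightarrow> p \<le> n" and "0 < N"
  obtains d where "0 < d" "d \<le> N ^ n" "\<And>i. 1 \<le> i \<Longrightarrow> i \<le> N \<Longrightarrow> i dvd d"
proof -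
  define P where "P = {p. prime p \<and> p \<le> n}"
  define e where "e p = Max {k. p ^ k \<le> N}" for p
  define d where "d = (\<Prod>p\<in>P. p ^ e p)"
  have finP: "finite P" by (simp add: P_def)
  have fine: "finite {k. p ^ k \<le> N}" if "p \<in> P" for p
  proof (rule finite_subset)
    have "1 < p" using that by (auto simp: P_def dest: prime_gt_1_nat)
    then have "k \<le> N" if "p ^ k \<le> N" for k
      using that power_gt_expt[of p k] by linarith
    then show "{k. p ^ k \<le> N} \<subseteq> {..N}" by auto
  qed simp
  \<comment> \<open>The exponent 0 shows that the set under \<open>Max\<close> is nonempty.\<close>
  have e: "p ^ e p \<le> N" if "p \<in> P" for p
    using Max_in[OF fine[OF that]] \<open>0 < N\<close> unfolding e_def by (force intro: exI[of _ 0])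
  show thesis
  proof
    show d0: "0 < d"
      unfolding d_def P_def by (intro prod_pos) (auto simp: prime_gt_0_nat)
    have "d \<le> (\<Prod>p\<in>P. N)"
      unfolding d_def by (intro prod_mono) (use e in auto)
    also have "\<dots> = N ^ card P" by simp
    also have "card P \<le> card {1..n}"
      by (intro card_mono) (auto simp: P_def dest: prime_gt_0_nat)
    then have "N ^ card P \<le> N ^ n"
      using \<open>0 < N\<close> by (intro power_increasing) auto
    finally show "d \<le> N ^ n" .
    show "i dvd d" if i: "1 \<le> i" "i \<le> N" for i
    proof (rule multiplicity_le_imp_dvd)
      show "i \<noteq> 0" using i by simp
      fix p :: nat assume p: "prime p"
      have pi: "p ^ multiplicity p i \<le> i"
        using i by (intro dvd_imp_le) (auto simp: multiplicity_dvd)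
      show "multiplicity p i \<le> multiplicity p d"
      proof (cases "p dvd i")
        case True
        then have "p \<in> P" using p no i dvd_imp_le[of p i] by (force simp: P_def)
        then have "multiplicity p i \<le> e p"
          unfolding e_def using pi i fine by (intro Max_ge) auto
        also have "e p \<le> multiplicity p d"
          using d0 p \<open>p \<in> P\<close> finP by (intro multiplicity_geI) (auto simp: d_def dvd_prodI prime_gt_1_nat)
        finally show ?thesis .
      qed (simp add: not_dvd_imp_multiplicity_0)
    qed
  qed
qed

lemma exists_prime_le_quadratic:
  obtains p :: nat where "prime p" "n < p" "p \<le> 8 * (n + 1)\<^sup>2"
proof (rule ccontr)
  assume "\<not> thesis"
  with that have no: "p \<le> n" if "prime p" "p \<le> 8 * (n + 1)\<^sup>2" for p
    using \<open>\<And>p. prime p \<Longrightarrow> n < p \<Longrightarrow> p \<le> 8 * (n + 1)\<^sup>2 \<Longrightarrow> thesis\<close> that by (meson not_le)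
  \<comment> \<open>\<open>2 * k\<close> is the claimed bound. A quadratic \<open>k\<close> is large
    enough because \<open>(2 * k) ^ n\<close> is at most 2 to an exponent of order
    \<open>2 * n\<^sup>2\<close>, while \<open>4 ^ k\<close> has exponent
    \<open>8 * (n + 1)\<^sup>2\<close>.\<close>
  define k where "k = 4 * (n + 1)\<^sup>2"
  have k0: "0 < k" by (simp add: k_def)
  obtain d where d: "0 < d" "d \<le> (2 * k) ^ n" "\<And>i. 1 \<le> i \<Longrightarrow> i \<le> 2 * k \<Longrightarrow> i dvd d"
    using common_multiple_le_power[of "2 * k" n] no k0 by (auto simp: k_def)
  have "k * (2 * k choose k) dvd d"
    using k0 d by (intro times_binomial_dvd) auto
  then have le: "k * (2 * k choose k) \<le> (2 * k) ^ n"
    using d by (meson dvd_imp_le le_trans)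
  have "4 ^ k / (2 * real k) \<le> real (2 * k choose k)"
    using central_binomial_lower_bound[OF k0] by simp
  then have "4 ^ k \<le> 2 * real (k * (2 * k choose k))"
    using k0 by (simp add: field_simps)
  then have "(4::nat) ^ k \<le> 2 * (k * (2 * k choose k))"
    by (metis (mono_tags, lifting) of_nat_le_iff of_nat_mult of_nat_numeral of_nat_power)
  also have "\<dots> \<le> 2 * (2 * k) ^ n" using le by simp
  \<comment> \<open>The crude estimate \<open>n + 1 \<le> 2 ^ n\<close> replaces any use of
    logarithms.\<close>
  also have "2 * k \<le> 2 ^ (3 + 2 * n)"
  proof -
    have "n + 1 \<le> 2 ^ n" using less_exp[of n] by (simp only: Suc_eq_plus1[symmetric] Suc_le_eq)
    then have "(n + 1)\<^sup>2 \<le> (2 ^ n)\<^sup>2" by (rule power_mono) simp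
    then show ?thesis by (simp add: k_def power_add power_mult power2_eq_square power_mult_distrib flip: power_mult_distrib)
  qed
  then have "2 * (2 * k) ^ n \<le> 2 * (2 ^ (3 + 2 * n)) ^ n"
    by (intro mult_left_mono power_mono) auto
  also have "\<dots> = 2 ^ (1 + (3 + 2 * n) * n)" by (simp add: power_mult power_add)
  also have "\<dots> < 2 ^ (2 * k)"
    by (intro power_strict_increasing) (auto simp: k_def power2_eq_square algebra_simps)
  also have "\<dots> = 4 ^ k" by (simp add: power_mult)
  finally show False by simp
qed


section \<open>Graphs, adjacency counts and isomorphisms\<close>

text \<open>The ones of the adjacency matrix. Their number is the quantity \<open>2 m - s\<close> of
  (P4) and (P5).\<close>

definition adj_pairs :: "'a ugraph \<Rightarrow> ('a \<times> 'a) set" where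
  "adj_pairs G = {(u, v) \<in> verts G \<times> verts G. {u, v} \<in> edges G}"

lemma finite_edges: "ugraph G \<Longrightarrow> finite (edges G)"
  unfolding ugraph_def by (rule finite_subset[of _ "Pow (verts G)"]) auto

lemma adj_vertsD: "ugraph G \<Longrightarrow> {u, v} \<in> edges G \<Longrightarrow> u \<in> verts G \<and> v \<in> verts G"
  unfolding ugraph_def by (fastforce simp: doubleton_eq_iff)

text \<open>Count the pairs by the fibres of \<open>(u, v)\<close> \<mapsto> \<open>{u, v}\<close>:
  the fibre over an edge \<open>e\<close> has \<open>card e\<close> elements, two for a proper edge
  and one for a loop. The second equation yields (P3) as soon as there is one proper edge.\<close>

lemma card_adj_pairs:
  assumes G: "ugraph G"
  shows "card (adj_pairs G) + num_loops G = 2 * num_edges G"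
    and "num_loops G + card {e \<in> edges G. card e = 2} = num_edges G"
proof -
  have fin: "finite (verts G)" "finite (edges G)" using G finite_edges by (auto simp: ugraph_def)
  define L where "L = {e \<in> edges G. card e = 1}"
  define M where "M = {e \<in> edges G. card e = 2}"
  have LM: "edges G = L \<union> M" "L \<inter> M = {}" "finite L" "finite M"
  proof -
    have "card e = 1 \<or> card e = 2" if e: "e \<in> edges G" for e
    proof -
      obtain u v where "e = {u, v}" using G e by (auto simp: ugraph_def)
      then show ?thesis by (simp add: card_insert_if)
    qed
    then show "edges G = L \<union> M" by (auto simp: L_def M_def)
  qed (use fin in \<open>auto simp: L_def M_def\<close>)
  have "L = (\<lambda>v. {v}) ` {v \<in> verts G. {v, v} \<in> edges G}"
    using adj_vertsD[OF G, of v v for v] by (auto simp: L_def card_1_singleton_iff)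
  then have l: "card L = num_loops G"
    unfolding num_loops_def by (simp add: card_image)
  have m: "num_edges G = card L + card M"
    unfolding num_edges_def using LM by (simp add: card_Un_disjoint)
  have finP: "finite (adj_pairs G)"
    by (rule finite_subset[of _ "verts G \<times> verts G"]) (auto simp: adj_pairs_def fin)
  have "card (adj_pairs G) = (\<Sum>e\<in>edges G. card {p \<in> adj_pairs G. {fst p, snd p} = e})"
  proof -
    have "adj_pairs G = (\<Union>e\<in>edges G. {p \<in> adj_pairs G. {fst p, snd p} = e})"
      by (auto simp: adj_pairs_def)
    then have "card (adj_pairs G) = card (\<Union>e\<in>edges G. {p \<in> adj_pairs G. {fst p, snd p} = e})"
      by simp
    also have "\<dots> = (\<Sum>e\<in>edges G. card {p \<in> adj_pairs G. {fst p, snd p} = e})"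
      using fin finP by (intro card_UN_disjoint) auto
    finally show ?thesis .
  qed
  also have "\<dots> = (\<Sum>e\<in>edges G. card e)"
  proof (rule sum.cong)
    fix e assume e: "e \<in> edges G"
    then obtain u v where uv: "u \<in> verts G" "v \<in> verts G" "e = {u, v}"
      using G by (auto simp: ugraph_def)
    then have "{p \<in> adj_pairs G. {fst p, snd p} = e} = {(u, v), (v, u)}"
      using e by (auto simp: adj_pairs_def doubleton_eq_iff insert_commute)
    then show "card {p \<in> adj_pairs G. {fst p, snd p} = e} = card e"
      by (simp add: uv card_insert_if)
  qed simp
  also have "\<dots> = (\<Sum>e\<in>L. card e) + (\<Sum>e\<in>M. card e)"
    using LM by (simp add: sum.union_disjoint)
  also have "\<dots> = card L + 2 * card M"
    by (simp add: L_def M_def)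
  finally show "card (adj_pairs G) + num_loops G = 2 * num_edges G"
    using l m by simp
  show "num_loops G + card {e \<in> edges G. card e = 2} = num_edges G"
    using l m by (simp add: M_def)
qed

lemma connected_graph_neighbour:
  assumes "ugraph G" "connected_graph G" "u \<in> verts G" "v \<in> verts G" "u \<noteq> v"
  obtains w where "w \<in> verts G" "w \<noteq> u" "{u, w} \<in> edges G"
proof (rule ccontr)
  assume no: "\<not> thesis"
  have "(u, v) \<in> {(x, y). {x, y} \<in> edges G}\<^sup>*"
    using assms by (simp add: connected_graph_def)
  then have "v = u"
    \<comment> \<open>A path starting at \<open>u\<close> can never leave \<open>u\<close>.\<close>
    by induction (use no that adj_vertsD[OF assms(1)] in blast)+
  with \<open>u \<noteq> v\<close> show False by simp
qed

text \<open>Conjugation with the enumerations \<open>\<beta>\<close> and \<open>\<gamma>\<close>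
  carries an isomorphism to a bijection of the index sets and back, so graphs can be compared
  through vertex positions instead of vertex names.\<close>

lemma graph_iso_reindex:
  assumes "bij_betw \<beta> A (verts G)" "bij_betw \<gamma> B (verts H)"
  shows "G \<simeq> H \<longleftrightarrow> (\<exists>\<sigma>. bij_betw \<sigma> A B \<and>
     (\<forall>i\<in>A. \<forall>j\<in>A. {\<beta> i, \<beta> j} \<in> edges G \<longleftrightarrow> {\<gamma> (\<sigma> i), \<gamma> (\<sigma> j)} \<in> edges H))"
    (is "_ \<longleftrightarrow> ?R")
proof
  assume "G \<simeq> H"
  then obtain \<pi> where \<pi>: "bij_betw \<pi> (verts G) (verts H)"
    "\<And>u v. u \<in> verts G \<Longrightarrow> v \<in> verts G \<Longrightarrow> {u, v} \<in> edges G \<longleftrightarrow> {\<pi> u, \<pi> v} \<in> edges H"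
    unfolding graph_iso_def by blast
  define \<sigma> where "\<sigma> = inv_into B \<gamma> \<circ> (\<pi> \<circ> \<beta>)"
  have "bij_betw \<sigma> A B"
    unfolding \<sigma>_def by (intro bij_betw_trans[OF bij_betw_trans[OF assms(1) \<pi>(1)]]
        bij_betw_inv_into assms(2))
  moreover have "\<beta> i \<in> verts G" "\<gamma> (\<sigma> i) = \<pi> (\<beta> i)" if "i \<in> A" for i
    using that assms \<pi>(1) unfolding \<sigma>_def
    by (auto simp: bij_betw_apply bij_betw_inv_into_right)
  ultimately show ?R using \<pi>(2) by (intro exI[of _ \<sigma>]) auto
next
  assume ?R
  then obtain \<sigma> where \<sigma>: "bij_betw \<sigma> A B"
    "\<And>i j. i \<in> A \<Longrightarrow> j \<in> A \<Longrightarrow> {\<beta> i, \<beta> j} \<in> edges G \<longleftrightarrow> {\<gamma> (\<sigma> i), \<gamma> (\<sigma> j)} \<in> edges H"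
    by blast
  define \<pi> where "\<pi> = (\<gamma> \<circ> \<sigma>) \<circ> inv_into A \<beta>"
  have "bij_betw \<pi> (verts G) (verts H)"
    unfolding \<pi>_def by (intro bij_betw_trans[OF bij_betw_inv_into[OF assms(1)]]
        bij_betw_trans[OF \<sigma>(1) assms(2)])
  moreover have "\<exists>i\<in>A. \<beta> i = u \<and> \<pi> u = \<gamma> (\<sigma> i)" if "u \<in> verts G" for u
    using that assms(1) bij_betw_inv_into_right[OF assms(1) that] unfolding \<pi>_def
    by (intro bexI[of _ "inv_into A \<beta> u"]) (auto intro: bij_betw_apply[OF bij_betw_inv_into])
  then have "{u, v} \<in> edges G \<longleftrightarrow> {\<pi> u, \<pi> v} \<in> edges H" if "u \<in> verts G" "v \<in> verts G" for u v
    using that \<sigma>(2) by metis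
  ultimately show "G \<simeq> H" unfolding graph_iso_def by blast
qed


section \<open>The reduction\<close>

definition index_adj :: "nat ugraph \<Rightarrow> nat \<Rightarrow> nat \<Rightarrow> bool" where
  "index_adj G i j \<longleftrightarrow> (let vs = sorted_list_of_set (verts G) in {vs ! i, vs ! j} \<in> edges G)"

lemma index_adj_commute: "index_adj G i j \<longleftrightarrow> index_adj G j i"
  by (simp add: index_adj_def insert_commute)

lemma bij_betw_sorted_list:
  assumes "finite A"
  shows "bij_betw (\<lambda>i. sorted_list_of_set A ! i) {..<card A} A"
  using bij_betw_nth[of "sorted_list_of_set A" "{..<card A}" A] assms by simp

lemma graph_iso_index:
  assumes "ugraph G" "ugraph H"
  shows "G \<simeq> H \<longleftrightarrow> (\<exists>\<sigma>. bij_betw \<sigma> {..<num_nodes G} {..<num_nodes H} \<and>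
     (\<forall>i<num_nodes G. \<forall>j<num_nodes G. index_adj G i j \<longleftrightarrow> index_adj H (\<sigma> i) (\<sigma> j)))"
  using graph_iso_reindex[OF bij_betw_sorted_list bij_betw_sorted_list, of G H] assms
  by (simp add: ugraph_def num_nodes_def index_adj_def Let_def Ball_def)

definition index_pairs :: "nat ugraph \<Rightarrow> (nat \<times> nat) set" where
  "index_pairs G = {(i, j). i < num_nodes G \<and> j < num_nodes G \<and> index_adj G i j}"

lemma finite_index_pairs [simp]: "finite (index_pairs G)"
  unfolding index_pairs_def by (rule finite_subset[of _ "{..<num_nodes G} \<times> {..<num_nodes G}"]) auto

text \<open>With loops at the vertices from \<open>loop_start G\<close> on, the edge contribution of \<open>G\<close> to
  \<open>2 m - s\<close> cancels, see \<open>card_adj_pairs_hub_graph\<close>.\<close>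

definition loop_start :: "nat ugraph \<Rightarrow> nat" where
  "loop_start G = card (index_pairs G) + 6 * num_nodes G + 3"

definition target_size :: "nat ugraph \<Rightarrow> nat" where
  "target_size G = (LEAST p. prime p \<and> loop_start G \<le> p)"

text \<open>Positions below \<open>n\<close> carry \<open>G\<close>, position \<open>n\<close> is
  the hub, and all later positions are padding. The guards \<open>i < n\<close> and
  \<open>j < n\<close> keep \<open>index_adj\<close> within the vertex list.\<close>

definition hub_adj :: "nat ugraph \<Rightarrow> nat \<Rightarrow> nat \<Rightarrow> bool" where
  "hub_adj G i j \<longleftrightarrow> (let n = num_nodes G in
     i < n \<and> j < n \<and> index_adj G i j \<or> i = n \<or> j = n \<or> i = j \<and> loop_start G \<le> i)"

definition hub_graph :: "nat ugraph \<Rightarrow> nat ugraph" where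
  "hub_graph G = UGraph {..<target_size G}
     {{i, j} | i j. i < target_size G \<and> j < target_size G \<and> hub_adj G i j}"

section \<open>Size of the hub graph and membership in the class\<close>

lemma target_size:
  shows "prime (target_size G)" "loop_start G \<le> target_size G"
    and "target_size G \<le> 8 * (loop_start G)\<^sup>2"
    and "loop_start G \<le> p \<Longrightarrow> p < target_size G \<Longrightarrow> \<not> prime p"
proof -
  \<comment> \<open>The bound gives a strictly larger prime, so it is applied to the predecessor of
    \<open>loop_start G\<close>, which is positive.\<close>
  obtain p where p: "prime p" "loop_start G - 1 < p" "p \<le> 8 * (loop_start G - 1 + 1)\<^sup>2"
    by (rule exists_prime_le_quadratic)
  moreover have "loop_start G > 0" by (simp add: loop_start_def)
  ultimately have p': "prime p \<and> loop_start G \<le> p" "p \<le> 8 * (loop_start G)\<^sup>2" by auto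
  show "prime (target_size G)" "loop_start G \<le> target_size G"
    using LeastI[of "\<lambda>p. prime p \<and> loop_start G \<le> p", OF p'(1)] by (simp_all add: target_size_def)
  show "target_size G \<le> 8 * (loop_start G)\<^sup>2"
    using Least_le[of "\<lambda>p. prime p \<and> loop_start G \<le> p", OF p'(1)] p'(2) by (simp add: target_size_def)
  show "loop_start G \<le> p \<Longrightarrow> p < target_size G \<Longrightarrow> \<not> prime p" for p
    unfolding target_size_def by (auto dest: not_less_Least)
qed

text \<open>The summand \<open>6 * num_nodes G\<close> is 0 modulo 6, so it leaves the residues in
  (P4) and (P5) alone, yet it pushes the padding loops beyond the hub and its successor.\<close>

lemma less_target_size:
  "6 * num_nodes G + 3 \<le> loop_start G" "num_nodes G + 2 < target_size G"
  using target_size(2)[of G] by (auto simp: loop_start_def)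

lemma hub_adj_commute: "hub_adj G i j \<longleftrightarrow> hub_adj G j i"
  using index_adj_commute[of G i j] by (auto simp: hub_adj_def Let_def)

lemma verts_hub_graph [simp]: "verts (hub_graph G) = {..<target_size G}"
  and num_nodes_hub_graph [simp]: "num_nodes (hub_graph G) = target_size G"
  by (simp_all add: hub_graph_def num_nodes_def)

lemma edges_hub_graph [simp]:
  assumes "i < target_size G" "j < target_size G"
  shows "{i, j} \<in> edges (hub_graph G) \<longleftrightarrow> hub_adj G i j"
  using assms hub_adj_commute by (auto simp: hub_graph_def doubleton_eq_iff)

lemma ugraph_hub_graph: "ugraph (hub_graph G)"
  by (auto simp: ugraph_def hub_graph_def)

lemma card_adj_pairs_hub_graph:
  "card (adj_pairs (hub_graph G)) + 6 * num_nodes G + 4 = 3 * target_size G"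
proof -
  define n N K where "n = num_nodes G" and "N = target_size G" and "K = loop_start G"
  have le: "n + 2 < N" "n < K" "K \<le> N"
    using less_target_size[of G] target_size(2)[of G] by (auto simp: n_def N_def K_def)
  have "adj_pairs (hub_graph G) = {(i, j). i < N \<and> j < N \<and> hub_adj G i j}"
    by (auto simp: adj_pairs_def N_def)
  \<comment> \<open>The pairs split into those of \<open>G\<close>, the row of the hub, the rest of
    its column, and the padding loops. The pair \<open>(n, n)\<close> is counted in the row
    only.\<close>
  also have "\<dots> = index_pairs G \<union> (({n} \<times> {..<N} \<union> ({..<N} - {n}) \<times> {n}) \<union> (\<lambda>i. (i, i)) ` {K..<N})"
    using le by (auto simp: hub_adj_def Let_def index_pairs_def n_def[symmetric] K_def[symmetric])
  also have "card \<dots> = card (index_pairs G) + (card ({n} \<times> {..<N}) + card (({..<N} - {n}) \<times> {n})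
      + card ((\<lambda>i. (i, i)) ` {K..<N}))"
  proof -
    have "index_pairs G \<inter> (({n} \<times> {..<N} \<union> ({..<N} - {n}) \<times> {n}) \<union> (\<lambda>i. (i, i)) ` {K..<N}) = {}"
      "({n} \<times> {..<N} \<union> ({..<N} - {n}) \<times> {n}) \<inter> (\<lambda>i. (i, i)) ` {K..<N} = {}"
      "({n} \<times> {..<N}) \<inter> (({..<N} - {n}) \<times> {n}) = {}"
      using le by (auto simp: index_pairs_def n_def)
    then show ?thesis by (simp add: card_Un_disjoint)
  qed
  \<comment> \<open>As \<open>K\<close> exceeds the number of index pairs by
    \<open>6 * n + 3\<close>, that number cancels and \<open>3 * N - 6 * n - 4\<close>
    remains.\<close>
  also have "\<dots> = card (index_pairs G) + (N + (N - 1) + (N - K))"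
    using le by (simp add: card_cartesian_product card_image inj_on_def)
  finally show ?thesis
    using le unfolding n_def N_def K_def by (simp add: loop_start_def)
qed

lemma hub_graph_in_class_G: "hub_graph G \<in> class_G"
proof -
  define n N where "n = num_nodes G" and "N = target_size G"
  have nN: "n + 2 < N" using less_target_size by (simp add: n_def N_def)
  have hub: "{i, n} \<in> edges (hub_graph G)" "{n, i} \<in> edges (hub_graph G)" if "i < N" for i
    using that nN by (simp_all add: N_def n_def hub_adj_def)
  note U = ugraph_hub_graph[of G]
  have "connected_graph (hub_graph G)"
    unfolding connected_graph_def
  proof (intro ballI)
    fix u v assume "u \<in> verts (hub_graph G)" "v \<in> verts (hub_graph G)"
    then have "(u, n) \<in> {(x, y). {x, y} \<in> edges (hub_graph G)}"
      "(n, v) \<in> {(x, y). {x, y} \<in> edges (hub_graph G)}"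
      using hub by (auto simp: N_def)
    then show "(u, v) \<in> {(x, y). {x, y} \<in> edges (hub_graph G)}\<^sup>*"
      by (meson r_into_rtrancl rtrancl_trans)
  qed
  \<comment> \<open>The loop at the hub would put the hub into both disjoint classes.\<close>
  moreover have "\<not> bipartite_graph (hub_graph G)"
  proof
    assume "bipartite_graph (hub_graph G)"
    then obtain A B where "A \<inter> B = {}" "\<exists>a\<in>A. \<exists>b\<in>B. {n, n} = {a, b}"
      unfolding bipartite_graph_def using hub(1)[of n] nN by force
    then show False by (auto simp: doubleton_eq_iff)
  qed
  moreover have "num_loops (hub_graph G) < num_edges (hub_graph G)"
  proof -
    have "{n, n + 1} \<in> {e \<in> edges (hub_graph G). card e = 2}"
      using hub(2)[of "n + 1"] nN by simp
    then have "0 < card {e \<in> edges (hub_graph G). card e = 2}"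
      using finite_edges[OF U] by (subst card_gt_0_iff) auto
    then show ?thesis using card_adj_pairs(2)[OF U] by linarith
  qed
  moreover have "\<not> 2 dvd (2 * num_edges (hub_graph G) - num_loops (hub_graph G))"
    "\<not> 3 dvd (2 * num_edges (hub_graph G) - num_loops (hub_graph G))"
  proof -
    have *: "2 * num_edges (hub_graph G) - num_loops (hub_graph G) = card (adj_pairs (hub_graph G))"
      using card_adj_pairs(1)[OF U] by linarith
    \<comment> \<open>A prime above 2 is odd, which makes \<open>3 * N - 6 * n - 4\<close> odd;
      modulo 3 this number is 2.\<close>
    have "odd N"
      using target_size(1)[of G] nN unfolding N_def by (intro prime_odd_nat) auto
    then show "\<not> 2 dvd (2 * num_edges (hub_graph G) - num_loops (hub_graph G))"
      unfolding * using card_adj_pairs_hub_graph[of G] unfolding N_def by presburger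
    show "\<not> 3 dvd (2 * num_edges (hub_graph G) - num_loops (hub_graph G))"
      unfolding * using card_adj_pairs_hub_graph[of G] by presburger
  qed
  ultimately show ?thesis
    using U target_size(1)[of G] by (simp add: class_G_def Gamma0_def)
qed

section \<open>Preservation and reflection of isomorphism\<close>

lemma graph_iso_hub_graph:
  "hub_graph G \<simeq> hub_graph H \<longleftrightarrow> (\<exists>\<tau>. bij_betw \<tau> {..<target_size G} {..<target_size H} \<and>
     (\<forall>i<target_size G. \<forall>j<target_size G. hub_adj G i j \<longleftrightarrow> hub_adj H (\<tau> i) (\<tau> j)))"
proof -
  have "{\<tau> i, \<tau> j} \<in> edges (hub_graph H) \<longleftrightarrow> hub_adj H (\<tau> i) (\<tau> j)"
    if "bij_betw \<tau> {..<target_size G} {..<target_size H}" "i < target_size G" "j < target_size G"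
    for \<tau> i j
    using bij_betw_apply[OF that(1)] that(2,3) by simp
  then show ?thesis
    unfolding graph_iso_def verts_hub_graph
    by (intro arg_cong[where f = Ex] ext conj_cong refl) (auto simp: Ball_def)
qed

text \<open>\<open>loop_start\<close> and \<open>target_size\<close> depend only on the numbers of
  vertices and of adjacent pairs, which are isomorphism invariants. Hence hub, padding and loops
  occupy the same positions in both hub graphs, and \<open>\<sigma>\<close> extends by the
  identity.\<close>

lemma hub_graph_iso:
  assumes "ugraph G" "ugraph H" "G \<simeq> H"
  shows "hub_graph G \<simeq> hub_graph H"
proof -
  obtain \<sigma> where \<sigma>: "bij_betw \<sigma> {..<num_nodes G} {..<num_nodes H}"
    "\<And>i j. i < num_nodes G \<Longrightarrow> j < num_nodes G \<Longrightarrow> index_adj G i j \<longleftrightarrow> index_adj H (\<sigma> i) (\<sigma> j)"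
    using assms by (auto simp: graph_iso_index)
  define n where "n = num_nodes G"
  have n: "num_nodes H = n" "num_nodes G = n"
    using bij_betw_same_card[OF \<sigma>(1)] by (simp_all add: n_def)
  note \<sigma> = \<sigma>[unfolded n]
  have lt: "\<sigma> i < n" if "i < n" for i
    using \<sigma>(1) that by (auto dest: bij_betw_apply)
  have "bij_betw (map_prod \<sigma> \<sigma>) (index_pairs G) (index_pairs H)"
    unfolding bij_betw_def
  proof
    show "inj_on (map_prod \<sigma> \<sigma>) (index_pairs G)"
      using \<sigma>(1) by (auto simp: inj_on_def index_pairs_def bij_betw_def n)
    have "(i, j) \<in> map_prod \<sigma> \<sigma> ` index_pairs G" if ij: "(i, j) \<in> index_pairs H" for i j
    proof -
      obtain i' j' where "i' < n" "j' < n" "i = \<sigma> i'" "j = \<sigma> j'"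
        using ij \<sigma>(1) unfolding index_pairs_def bij_betw_def n by blast
      with ij show ?thesis
        using \<sigma>(2) by (force simp: index_pairs_def n)
    qed
    then show "map_prod \<sigma> \<sigma> ` index_pairs G = index_pairs H"
      using \<sigma>(2) lt by (auto simp: index_pairs_def n)
  qed
  then have K: "loop_start G = loop_start H"
    by (simp add: loop_start_def n bij_betw_same_card)
  then have N: "target_size G = target_size H" by (simp add: target_size_def)
  define \<tau> where "\<tau> i = (if i < n then \<sigma> i else i)" for i
  have "bij_betw \<tau> ({..<n} \<union> {n..<target_size G}) ({..<n} \<union> {n..<target_size G})"
  proof (rule bij_betw_combine)
    show "bij_betw \<tau> {..<n} {..<n}"
      using \<sigma>(1) by (subst bij_betw_cong[of _ _ \<sigma>]) (auto simp: \<tau>_def)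
    show "bij_betw \<tau> {n..<target_size G} {n..<target_size G}"
      by (subst bij_betw_cong[of _ _ id]) (auto simp: \<tau>_def)
  qed auto
  moreover have "{..<n} \<union> {n..<target_size G} = {..<target_size G}"
    using less_target_size(2)[of G] by (auto simp: n)
  moreover have "hub_adj G i j \<longleftrightarrow> hub_adj H (\<tau> i) (\<tau> j)" for i j
    using lt[of i] lt[of j] \<sigma>(2)[of i j] less_target_size(1)[of G] less_target_size(1)[of H]
    by (auto simp: hub_adj_def Let_def \<tau>_def n K)
  ultimately show ?thesis
    unfolding graph_iso_hub_graph N by auto
qed

text \<open>A single vertex has no neighbour besides itself, so it cannot be told from padding: with
  or without its loop the hub graphs are isomorphic. Here the number of edges has to decide.\<close>

lemma iso_of_num_nodes_le_1:
  assumes "ugraph G" "ugraph H" "num_nodes G = num_nodes H" "num_edges G = num_edges H"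
    and "num_nodes G \<le> 1"
  shows "G \<simeq> H"
proof (cases "num_nodes G = 0")
  case True
  then have "verts G = {}" "verts H = {}" using assms by (auto simp: num_nodes_def ugraph_def)
  then show ?thesis by (auto simp: graph_iso_def bij_betw_def)
next
  case False
  with assms(3,5) have "card (verts G) = 1" "card (verts H) = 1"
    unfolding num_nodes_def by linarith+
  then obtain a b where ab: "verts G = {a}" "verts H = {b}"
    by (meson card_1_singletonE)
  have "edges G \<subseteq> {{a}}" "edges H \<subseteq> {{b}}"
    using assms(1,2) by (auto simp: ugraph_def ab)
  then have "{a} \<in> edges G \<longleftrightarrow> num_edges G \<noteq> 0" "{b} \<in> edges H \<longleftrightarrow> num_edges H \<noteq> 0"
    unfolding num_edges_def by (auto dest: subset_singletonD)
  with assms(4) show ?thesis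
    unfolding graph_iso_def by (intro exI[of _ "\<lambda>_. b"]) (auto simp: ab bij_betw_def)
qed

text \<open>An isomorphism fixes the hub. A vertex of \<open>G\<close> has a neighbour other than
  itself and the hub, and this property survives the isomorphism; in the hub graph of
  \<open>H\<close> it forces a position below \<open>n\<close>. So the isomorphism restricts to the
  original vertices.\<close>

lemma iso_of_hub_graph_iso:
  assumes G: "ugraph G" "connected_graph G" and H: "ugraph H"
    and n: "num_nodes H = num_nodes G" and n2: "2 \<le> num_nodes G"
    and iso: "hub_graph G \<simeq> hub_graph H"
  shows "G \<simeq> H"
proof -
  define n where "n = num_nodes G"
  have nn: "num_nodes G = n" "num_nodes H = n" using n by (simp_all add: n_def)
  obtain \<tau> where \<tau>: "bij_betw \<tau> {..<target_size G} {..<target_size H}"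
    "\<And>i j. i < target_size G \<Longrightarrow> j < target_size G \<Longrightarrow> hub_adj G i j \<longleftrightarrow> hub_adj H (\<tau> i) (\<tau> j)"
    using iso unfolding graph_iso_hub_graph by blast
  define N where "N = target_size G"
  have NH: "target_size H = N" "target_size G = N"
    using bij_betw_same_card[OF \<tau>(1)] by (simp_all add: N_def)
  note \<tau> = \<tau>[unfolded NH]
  have nN: "n + 2 < N" "6 * n + 3 \<le> loop_start G" "6 * n + 3 \<le> loop_start H"
    using less_target_size[of G] less_target_size[of H] by (simp_all add: nn NH)
  have inj: "\<tau> i = \<tau> j \<longleftrightarrow> i = j" if "i < N" "j < N" for i j
    using \<tau>(1) that by (auto simp: bij_betw_def inj_on_def)
  have surj: "\<exists>i<N. \<tau> i = j" if "j < N" for j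
    using \<tau>(1) that unfolding bij_betw_def by (metis imageE lessThan_iff)
  have dom: "hub_adj H (\<tau> n) j" if j: "j < N" for j
  proof -
    obtain i where "i < N" "\<tau> i = j" using surj[OF j] by blast
    then show ?thesis using \<tau>(2)[of n i] nN by (auto simp: hub_adj_def nn)
  qed
  \<comment> \<open>The image of the hub is adjacent to every vertex, and \<open>n + 1\<close> is
    padding without a loop, with the hub as its only neighbour.\<close>
  have hub: "\<tau> n = n"
    using dom[of "n + 1"] dom[of 0] nN n2 by (auto simp: hub_adj_def Let_def nn)
  have nb: "\<exists>j<n. j \<noteq> i \<and> index_adj G i j" if i: "i < n" for i
  proof -
    define vs where "vs = sorted_list_of_set (verts G)"
    have bij: "bij_betw (\<lambda>i. vs ! i) {..<n} (verts G)"
      using bij_betw_sorted_list[of "verts G"] G by (simp add: vs_def n_def num_nodes_def ugraph_def)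
    \<comment> \<open>Any second vertex serves as the goal of a path leaving
      \<open>i\<close>.\<close>
    define k :: nat where "k = (if i = 0 then 1 else 0)"
    have k: "k < n" "k \<noteq> i" using n2 by (auto simp: k_def nn)
    have "vs ! i \<in> verts G" "vs ! k \<in> verts G" "vs ! i \<noteq> vs ! k"
      using bij i k by (auto simp: bij_betw_def inj_on_def)
    then obtain w where w: "w \<in> verts G" "w \<noteq> vs ! i" "{vs ! i, w} \<in> edges G"
      using connected_graph_neighbour[OF G] by blast
    obtain j where "j < n" "w = vs ! j" using bij w(1) by (auto simp: bij_betw_def)
    with w show ?thesis by (auto simp: index_adj_def vs_def Let_def)
  qed
  have lt: "\<tau> i < n" if i: "i < n" for i
  proof -
    obtain j where j: "j < n" "j \<noteq> i" "index_adj G i j" using nb[OF i] by blast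
    have "hub_adj G i j" using i j by (simp add: hub_adj_def nn)
    then have "hub_adj H (\<tau> i) (\<tau> j)" using \<tau>(2)[of i j] i j nN by simp
    \<comment> \<open>Two distinct vertices, neither of them the hub, are adjacent only through an
      edge of \<open>H\<close>.\<close>
    moreover have "\<tau> i \<noteq> n" "\<tau> j \<noteq> n" "\<tau> i \<noteq> \<tau> j"
      using inj[of i n] inj[of j n] inj[of i j] hub i j nN by auto
    ultimately show ?thesis by (auto simp: hub_adj_def Let_def nn)
  qed
  have "inj_on \<tau> {..<n}" using inj nN by (auto simp: inj_on_def)
  moreover have "\<tau> ` {..<n} = {..<n}"
    using \<open>inj_on \<tau> {..<n}\<close> lt by (intro endo_inj_surj) auto
  ultimately have "bij_betw \<tau> {..<n} {..<n}" by (simp add: bij_betw_def)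
  moreover have "index_adj G i j \<longleftrightarrow> index_adj H (\<tau> i) (\<tau> j)" if "i < n" "j < n" for i j
    using \<tau>(2)[of i j] that lt[of i] lt[of j] nN by (auto simp: hub_adj_def Let_def nn)
  ultimately show ?thesis using G H by (auto simp: graph_iso_index nn)
qed


section \<open>Reasoning about programs\<close>

text \<open>Total correctness as a weakest precondition that also sees the step count; the
  existential asserts termination.\<close>

definition runs :: "com \<Rightarrow> state \<Rightarrow> (nat \<Rightarrow> state \<Rightarrow> bool) \<Rightarrow> bool" where
  "runs c s Q \<longleftrightarrow> (\<exists>t s'. exec c s t s' \<and> Q t s')"

inductive_cases exec_SkipE: "exec Skip s t s'"
inductive_cases exec_ConstE: "exec (Const x k) s t s'"
inductive_cases exec_AddE: "exec (Add x y z) s t s'"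
inductive_cases exec_SubE: "exec (Sub x y z) s t s'"
inductive_cases exec_LoadE: "exec (Load x y) s t s'"
inductive_cases exec_PrintE: "exec (Print x) s t s'"
inductive_cases exec_SeqE: "exec (Seq c d) s t s'"
inductive_cases exec_IfE: "exec (IfLess x y c d) s t s'"

lemma runs_simps [simp]:
  "runs Skip s Q \<longleftrightarrow> Q 1 s"
  "runs (Const x k) s Q \<longleftrightarrow> Q 1 (s\<lparr>reg := (reg s)(x := k)\<rparr>)"
  "runs (Add x y z) s Q \<longleftrightarrow> Q 1 (s\<lparr>reg := (reg s)(x := reg s y + reg s z)\<rparr>)"
  "runs (Sub x y z) s Q \<longleftrightarrow> Q 1 (s\<lparr>reg := (reg s)(x := reg s y - reg s z)\<rparr>)"
  "runs (Load x y) s Q \<longleftrightarrow> Q 1 (s\<lparr>reg := (reg s)(x := mem s (reg s y))\<rparr>)"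
  "runs (Print x) s Q \<longleftrightarrow> Q 1 (s\<lparr>out := out s @ [reg s x]\<rparr>)"
  "runs (Seq c d) s Q \<longleftrightarrow> runs c s (\<lambda>t s'. runs d s' (\<lambda>t'. Q (t + t')))"
  "runs (IfLess x y c d) s Q \<longleftrightarrow>
     (if reg s x < reg s y then runs c s (\<lambda>t. Q (1 + t)) else runs d s (\<lambda>t. Q (1 + t)))"
  unfolding runs_def
  by (auto elim!: exec_SkipE exec_ConstE exec_AddE exec_SubE exec_LoadE exec_PrintE exec_SeqE
      exec_IfE intro: exec.intros simp del: One_nat_def plus_1_eq_Suc)
    auto

lemma runs_mono: "runs c s Q \<Longrightarrow> (\<And>t s'. Q t s' \<Longrightarrow> Q' t s') \<Longrightarrow> runs c s Q'"
  unfolding runs_def by blast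

text \<open>\<open>\<mu>\<close> is the variant and bounds the number of iterations. Each costs at
  most \<open>T\<close> plus one test, and the final failing test contributes the last 1.\<close>

lemma runs_WhileLess:
  assumes "I s"
    and body: "\<And>s. I s \<Longrightarrow> reg s x < reg s y \<Longrightarrow>
      runs c s (\<lambda>t s'. t \<le> T \<and> I s' \<and> \<mu> s' < (\<mu> s :: nat))"
    and post: "\<And>t s'. t \<le> \<mu> s * (T + 1) + 1 \<Longrightarrow> I s' \<Longrightarrow> \<not> reg s' x < reg s' y \<Longrightarrow> Q t s'"
  shows "runs (WhileLess x y c) s Q"
proof -
  have "\<exists>t s'. exec (WhileLess x y c) s t s' \<and> t \<le> \<mu> s * (T + 1) + 1 \<and> I s' \<and> \<not> reg s' x < reg s' y"
    using \<open>I s\<close>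
  proof (induction "\<mu> s" arbitrary: s rule: less_induct)
    case less
    show ?case
    proof (cases "reg s x < reg s y")
      case True
      obtain t1 s1 where 1: "exec c s t1 s1" "t1 \<le> T" "I s1" "\<mu> s1 < \<mu> s"
        using body[OF less.prems True] by (auto simp: runs_def)
      obtain t2 s2 where 2: "exec (WhileLess x y c) s1 t2 s2" "t2 \<le> \<mu> s1 * (T + 1) + 1"
        "I s2" "\<not> reg s2 x < reg s2 y"
        using less.hyps[OF 1(4,3)] by blast
      have "(\<mu> s1 + 1) * (T + 1) \<le> \<mu> s * (T + 1)"
        using 1(4) by (intro mult_right_mono) auto
      then have "1 + t1 + t2 \<le> \<mu> s * (T + 1) + 1"
        using 1(2) 2(2) by (simp add: algebra_simps)
      with 1 2 True show ?thesis by (blast intro: exec.WhileTrue)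
    next
      case False
      then show ?thesis using less.prems by (auto intro!: exI exec.WhileFalse)
    qed
  qed
  then show ?thesis unfolding runs_def using post by blast
qed


section \<open>The program\<close>

abbreviation seq_com :: "com \<Rightarrow> com \<Rightarrow> com"  (infixr ";;" 60) where
  "c ;; d \<equiv> Seq c d"

text \<open>Registers: 0 number \<open>n\<close> of vertices, 1 \<open>loop_start\<close>, 2 \<open>target_size\<close> (or the current
  candidate), 3 and 4 row and column, 5 position in the input matrix, 6 the constant 1, 7 scratch,
  8 primality flag, 10 the constant 0.\<close>

definition count_row :: com where
  "count_row = WhileLess 4 0 (Load 7 5 ;; Add 1 1 7 ;; Add 5 5 6 ;; Add 4 4 6)"

definition count_prog :: com where
  "count_prog = WhileLess 3 0 (Const 4 0 ;; count_row ;; Add 3 3 6)"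

text \<open>Without division, divisibility is tested by running through the multiples of register 3
  until register 2 is reached or overshot.\<close>

definition trial_division :: com where
  "trial_division = WhileLess 7 2 (Add 7 7 3)"

definition prime_test :: com where
  "prime_test = WhileLess 3 2
     (Const 7 0 ;; trial_division ;; IfLess 2 7 Skip (Const 8 0) ;; Add 3 3 6)"

text \<open>The candidate is incremented before each test, so the search has to start one below the
  first admissible value.\<close>

definition prime_search :: com where
  "prime_search = WhileLess 8 6 (Add 2 2 6 ;; Const 8 1 ;; Const 3 2 ;; prime_test)"

definition print_verts :: com where
  "print_verts = WhileLess 3 2 (Print 3 ;; Add 3 3 6)"

text \<open>With only \<open><\<close> available, equality is the case in which both comparisons
  fail; this is how the hub row and column and the diagonal are recognised.\<close>

definition print_entry :: com where
  "print_entry =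
     IfLess 3 0
       (IfLess 4 0 (Load 7 5 ;; Add 5 5 6) (IfLess 0 4 (Const 7 0) (Const 7 1)))
       (IfLess 0 3
         (IfLess 4 0 (Const 7 0)
           (IfLess 0 4
             (IfLess 3 4 (Const 7 0) (IfLess 4 3 (Const 7 0) (IfLess 3 1 (Const 7 0) (Const 7 1))))
             (Const 7 1)))
         (Const 7 1)) ;;
     Print 7"

definition print_row :: com where
  "print_row = WhileLess 4 2 (print_entry ;; Add 4 4 6)"

definition print_rows :: com where
  "print_rows = WhileLess 3 2 (Const 4 0 ;; print_row ;; Add 3 3 6)"

text \<open>Register 10 is still 0, so the first load reads \<open>n\<close> from address 0. The
  matrix starts at address \<open>n + 1\<close>, behind the vertex list; register 5 is set there
  once for counting and again for copying. The six additions form \<open>6 * n\<close>.\<close>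

definition hub_prog :: com where
  "hub_prog =
     Load 0 10 ;; Const 6 1 ;; Add 5 0 6 ;; count_prog ;;
     Const 7 3 ;; Add 1 1 7 ;;
     Add 1 1 0 ;; Add 1 1 0 ;; Add 1 1 0 ;; Add 1 1 0 ;; Add 1 1 0 ;; Add 1 1 0 ;;
     Sub 2 1 6 ;; prime_search ;;
     Print 2 ;; Const 3 0 ;; print_verts ;;
     Add 5 0 6 ;; Const 3 0 ;; print_rows"

definition frame :: "nat set \<Rightarrow> state \<Rightarrow> state \<Rightarrow> bool" where
  "frame X s s' \<longleftrightarrow> mem s' = mem s \<and> (\<forall>x. x \<notin> X \<longrightarrow> reg s' x = reg s x)"

section \<open>Correctness and step counts of the subprograms\<close>

lemma runs_count_row:
  assumes s: "reg s 0 = n" "reg s 4 = 0" "reg s 5 = q" "reg s 6 = 1"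
    and a: "\<And>j. j < n \<Longrightarrow> mem s (q + j) = a j"
  shows "runs count_row s (\<lambda>t s'. t \<le> 5 * n + 1 \<and> frame {1, 4, 5, 7} s s' \<and> out s' = out s \<and>
     reg s' 1 = reg s 1 + (\<Sum>j<n. a j) \<and> reg s' 5 = q + n)"
  unfolding count_row_def
proof (rule runs_WhileLess[where T = 4 and \<mu> = "\<lambda>s. n - reg s 4" and
      I = "\<lambda>s'. frame {1, 4, 5, 7} s s' \<and> out s' = out s \<and> reg s' 4 \<le> n \<and>
        reg s' 1 = reg s 1 + (\<Sum>j<reg s' 4. a j) \<and> reg s' 5 = q + reg s' 4"], goal_cases)
  case 1
  show ?case using s by (simp add: frame_def)
next
  case (2 s')
  then show ?case using s a by (auto simp: frame_def)
next
  case (3 t s')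
  then have "reg s' 4 = n" using s by (simp add: frame_def)
  with 3 show ?case using s by (simp add: add.commute)
qed

lemma runs_count_prog:
  assumes s: "reg s 0 = n" "reg s 3 = 0" "reg s 5 = q" "reg s 6 = 1"
    and a: "\<And>i j. i < n \<Longrightarrow> j < n \<Longrightarrow> mem s (q + i * n + j) = a i j"
  shows "runs count_prog s (\<lambda>t s'. t \<le> n * (5 * n + 4) + 1 \<and>
     frame {1, 3, 4, 5, 7} s s' \<and> out s' = out s \<and> reg s' 1 = reg s 1 + (\<Sum>i<n. \<Sum>j<n. a i j))"
  unfolding count_prog_def
proof (rule runs_WhileLess[where T = "5 * n + 3" and \<mu> = "\<lambda>s. n - reg s 3" and
      I = "\<lambda>s'. frame {1, 3, 4, 5, 7} s s' \<and> out s' = out s \<and> reg s' 3 \<le> n \<and>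
        reg s' 1 = reg s 1 + (\<Sum>i<reg s' 3. \<Sum>j<n. a i j) \<and> reg s' 5 = q + reg s' 3 * n"], goal_cases)
  case 1
  show ?case using s by (simp add: frame_def)
next
  case (2 s')
  then have i: "reg s' 3 < n" using s by (simp add: frame_def)
  show ?case
    unfolding runs_simps
    by (rule runs_mono, rule runs_count_row[where n = n and q = "q + reg s' 3 * n" and a = "a (reg s' 3)"])
      (use 2 s i a in \<open>auto simp: frame_def\<close>)
next
  case (3 t s')
  then have "reg s' 3 = n" using s by (simp add: frame_def)
  with 3 show ?case using s by (simp add: add.commute)
qed

text \<open>On exit register 7 is a multiple of \<open>a\<close> in the interval from
  \<open>N\<close> to \<open>N + a - 1\<close>, and it equals \<open>N\<close> exactly if
  \<open>a\<close> divides \<open>N\<close>.\<close>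

lemma runs_trial_division:
  assumes s: "reg s 2 = N" "reg s 3 = a" "reg s 7 = 0" and "0 < a"
  shows "runs trial_division s (\<lambda>t s'. t \<le> 2 * N + 1 \<and>
     frame {7} s s' \<and> out s' = out s \<and> (N < reg s' 7 \<longleftrightarrow> \<not> a dvd N))"
  unfolding trial_division_def
proof (rule runs_WhileLess[where T = 1 and \<mu> = "\<lambda>s. N - reg s 7" and
      I = "\<lambda>s'. frame {7} s s' \<and> out s' = out s \<and> a dvd reg s' 7 \<and> reg s' 7 < N + a"], goal_cases)
  case 1
  show ?case using s \<open>0 < a\<close> by (simp add: frame_def)
next
  case (2 s')
  then show ?case using s \<open>0 < a\<close> by (auto simp: frame_def)
next
  case (3 t s')
  define r where "r = reg s' 7"
  have r: "a dvd r" "r < N + a" "N \<le> r" using 3 s by (auto simp: r_def frame_def)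
  have "\<not> a dvd N" if "N < r"
  proof
    assume "a dvd N"
    with r(1) have "a dvd r - N" by (rule dvd_diff_nat)
    then show False using that r(2) by (auto dest: dvd_imp_le)
  qed
  then have "N < r \<longleftrightarrow> \<not> a dvd N" using r(1,3) by (cases "N = r") auto
  with 3 show ?case using s by (simp add: r_def)
qed

lemma runs_prime_test:
  assumes s: "reg s 2 = N" "reg s 3 = 2" "reg s 6 = 1" "reg s 8 = 1" and "2 \<le> N"
  shows "runs prime_test s (\<lambda>t s'. t \<le> N * (2 * N + 6) + 1 \<and>
     frame {3, 7, 8} s s' \<and> out s' = out s \<and> reg s' 8 = (if prime N then 1 else 0))"
proof -
  \<comment> \<open>\<open>F a\<close> is the flag once all divisors from 2 up to
    \<open>a - 1\<close> are tried; the range is empty at the start \<open>a = 2\<close>.\<close>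
  define F where "F a = (if \<exists>d\<in>{2..<a}. d dvd N then 0 else 1 :: nat)" for a
  have F: "F (Suc a) = (if a dvd N then 0 else F a)" if "2 \<le> a" for a
    using that by (auto simp: F_def less_Suc_eq)
  have FN: "F N = (if prime N then 1 else 0)"
    using \<open>2 \<le> N\<close> by (auto simp: F_def prime_nat_iff')
  show ?thesis
    unfolding prime_test_def
  proof (rule runs_WhileLess[where T = "2 * N + 5" and \<mu> = "\<lambda>s. N - reg s 3" and
        I = "\<lambda>s'. frame {3, 7, 8} s s' \<and> out s' = out s \<and> 2 \<le> reg s' 3 \<and> reg s' 3 \<le> N \<and>
          reg s' 8 = F (reg s' 3)"], goal_cases)
    case 1
    show ?case using s \<open>2 \<le> N\<close> by (simp add: frame_def F_def)
  next
    case (2 s')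
    then have i: "reg s' 3 < N" using s by (simp add: frame_def)
    show ?case
      unfolding runs_simps
      by (rule runs_mono, rule runs_trial_division[where N = N and a = "reg s' 3"])
        (use 2 s i F in \<open>auto simp: frame_def\<close>)
  next
    case (3 t s')
    then have "reg s' 3 = N" using s by (simp add: frame_def)
    moreover have "(N - reg s 3) * (2 * N + 5 + 1) \<le> N * (2 * N + 6)"
      by (intro mult_mono) auto
    ultimately show ?case using 3 FN by simp
  qed
qed

lemma runs_prime_search:
  assumes s: "reg s 2 = M" "reg s 6 = 1" "reg s 8 = 0"
    and P: "1 \<le> M" "M < P" "prime P" "\<And>p. M < p \<Longrightarrow> p < P \<Longrightarrow> \<not> prime p"
  shows "runs prime_search s (\<lambda>t s'. t \<le> P * (P * (2 * P + 6) + 5) + 1 \<and>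
     frame {2, 3, 7, 8} s s' \<and> out s' = out s \<and> reg s' 2 = P)"
  unfolding prime_search_def
\<comment> \<open>No prime lies strictly between \<open>M\<close> and \<open>P\<close>, so the flag
  is raised exactly when the candidate is \<open>P\<close>. Each test is charged at the cost of the
  largest candidate.\<close>
proof (rule runs_WhileLess[where T = "P * (2 * P + 6) + 4" and \<mu> = "\<lambda>s. P - reg s 2" and
      I = "\<lambda>s'. frame {2, 3, 7, 8} s s' \<and> out s' = out s \<and> M \<le> reg s' 2 \<and> reg s' 2 \<le> P \<and>
        reg s' 8 = (if reg s' 2 = P then 1 else 0)"], goal_cases)
  case 1
  show ?case using s P(2) by (simp add: frame_def)
next
  case (2 s')
  define N where "N = reg s' 2"
  have N: "N < P" "M \<le> N" using 2 s by (auto simp: frame_def N_def split: if_splits)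
  have prime: "prime (Suc N) \<longleftrightarrow> Suc N = P"
    using N P(3) P(4)[of "Suc N"] by (cases "Suc N = P") auto
  have "Suc N * (2 * Suc N + 6) \<le> P * (2 * P + 6)"
    using N by (intro mult_mono) auto
  then show ?case
    unfolding runs_simps
    by - (rule runs_mono, rule runs_prime_test[where N = "Suc N"],
      use 2 s N P(1) prime in \<open>auto simp: frame_def N_def\<close>)
next
  case (3 t s')
  have "reg s' 2 = P" using 3 s by (auto simp: frame_def split: if_splits)
  moreover have "(P - reg s 2) * (P * (2 * P + 6) + 4 + 1) \<le> P * (P * (2 * P + 6) + 5)"
    by (intro mult_mono) auto
  ultimately show ?case using 3 by simp
qed

lemma runs_print_verts:
  assumes s: "reg s 2 = N" "reg s 3 = 0" "reg s 6 = 1"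
  shows "runs print_verts s (\<lambda>t s'. t \<le> 3 * N + 1 \<and> frame {3} s s' \<and> out s' = out s @ [0..<N])"
  unfolding print_verts_def
proof (rule runs_WhileLess[where T = 2 and \<mu> = "\<lambda>s. N - reg s 3" and
      I = "\<lambda>s'. frame {3} s s' \<and> reg s' 3 \<le> N \<and> out s' = out s @ [0..<reg s' 3]"], goal_cases)
  case 1
  show ?case using s by (simp add: frame_def)
next
  case (2 s')
  then show ?case using s by (auto simp: frame_def)
next
  case (3 t s')
  then have "reg s' 3 = N" using s by (simp add: frame_def)
  with 3 show ?case using s by (simp add: add.commute)
qed

lemma runs_print_entry:
  assumes s: "reg s 0 = n" "reg s 1 = K" "reg s 3 = i" "reg s 4 = j" "reg s 6 = 1"
    and "n < K"
  shows "runs print_entry s (\<lambda>t s'. t \<le> 9 \<and> frame {5, 7} s s' \<and>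
     reg s' 5 = (if i < n \<and> j < n then Suc (reg s 5) else reg s 5) \<and>
     out s' = out s @ [if i < n \<and> j < n then mem s (reg s 5)
       else if i = n \<or> j = n \<or> i = j \<and> K \<le> i then 1 else 0])"
  using \<open>n < K\<close> unfolding print_entry_def by (auto simp: s s(2)[unfolded One_nat_def] frame_def)

lemma runs_print_row:
  assumes s: "reg s 0 = n" "reg s 1 = K" "reg s 2 = N" "reg s 3 = i" "reg s 4 = 0" "reg s 6 = 1"
    and n: "n < K" "n \<le> N" and p: "i < n \<Longrightarrow> reg s 5 = q"
    and b: "\<And>j. j < N \<Longrightarrow> b j = (if i < n \<and> j < n then mem s (q + j)
         else if i = n \<or> j = n \<or> i = j \<and> K \<le> i then 1 else 0)"
  shows "runs print_row s (\<lambda>t s'. t \<le> 11 * N + 1 \<and> frame {4, 5, 7} s s' \<and>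
     out s' = out s @ map b [0..<N] \<and> (i < n \<longrightarrow> reg s' 5 = q + n))"
  unfolding print_row_def
\<comment> \<open>In a row of \<open>G\<close> the input pointer stops after column
  \<open>n - 1\<close>, hence the minimum; this leaves it at the start of the next row.\<close>
proof (rule runs_WhileLess[where T = 10 and \<mu> = "\<lambda>s. N - reg s 4" and
      I = "\<lambda>s'. frame {4, 5, 7} s s' \<and> reg s' 4 \<le> N \<and> out s' = out s @ map b [0..<reg s' 4] \<and>
        (i < n \<longrightarrow> reg s' 5 = q + min (reg s' 4) n)"], goal_cases)
  case 1
  show ?case using s p by (simp add: frame_def)
next
  case (2 s')
  then have j: "reg s' 4 < N" using s by (simp add: frame_def)
  show ?case
    unfolding runs_simps
    by (rule runs_mono, rule runs_print_entry[where n = n and K = K and i = i and j = "reg s' 4"])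
      (use 2 s j n(1) in \<open>auto simp: frame_def b min_def\<close>)
next
  case (3 t s')
  then have "reg s' 4 = N" using s by (simp add: frame_def)
  with 3 show ?case using s n by simp
qed

lemma runs_print_rows:
  assumes s: "reg s 0 = n" "reg s 1 = K" "reg s 2 = N" "reg s 3 = 0" "reg s 5 = q" "reg s 6 = 1"
    and n: "n < K" "n \<le> N"
    and b: "\<And>i j. i < N \<Longrightarrow> j < N \<Longrightarrow> b i j = (if i < n \<and> j < n then mem s (q + i * n + j)
         else if i = n \<or> j = n \<or> i = j \<and> K \<le> i then 1 else 0)"
  shows "runs print_rows s (\<lambda>t s'. t \<le> N * (11 * N + 4) + 1 \<and>
     out s' = out s @ concat (map (\<lambda>i. map (b i) [0..<N]) [0..<N]))"
  unfolding print_rows_def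
\<comment> \<open>The pointer is tracked only while rows of \<open>G\<close> remain to be
  copied.\<close>
proof (rule runs_WhileLess[where T = "11 * N + 3" and \<mu> = "\<lambda>s. N - reg s 3" and
      I = "\<lambda>s'. frame {3, 4, 5, 7} s s' \<and> reg s' 3 \<le> N \<and>
        out s' = out s @ concat (map (\<lambda>i. map (b i) [0..<N]) [0..<reg s' 3]) \<and>
        (reg s' 3 < n \<longrightarrow> reg s' 5 = q + reg s' 3 * n)"], goal_cases)
  case 1
  show ?case using s by (simp add: frame_def)
next
  case (2 s')
  then have i: "reg s' 3 < N" using s by (simp add: frame_def)
  show ?case
    unfolding runs_simps
    by (rule runs_mono, rule runs_print_row[where n = n and K = K and N = N and i = "reg s' 3"
          and q = "q + reg s' 3 * n" and b = "b (reg s' 3)"])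
      (use 2 s i n in \<open>auto simp: frame_def b\<close>)
next
  case (3 t s')
  then have "reg s' 3 = N" using s by (simp add: frame_def)
  with 3 show ?case using s by (simp add: add.commute)
qed


section \<open>Layout of the encodings\<close>

lemma nth_concat_map_map:
  assumes "i < length us" "j < length vs"
  shows "concat (map (\<lambda>u. map (g u) vs) us) ! (i * length vs + j) = g (us ! i) (vs ! j)"
  using assms
proof (induction us arbitrary: i)
  case (Cons u us)
  then show ?case by (cases i) (auto simp: nth_append add.assoc)
qed simp

lemma length_sorted_verts: "length (sorted_list_of_set (verts G)) = num_nodes G"
  by (simp add: num_nodes_def)

lemma mem_initial_state_encode:
  shows "mem (initial_state (encode G)) 0 = num_nodes G"
    and "i < num_nodes G \<Longrightarrow> j < num_nodes G \<Longrightarrow>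
      mem (initial_state (encode G)) (num_nodes G + 1 + i * num_nodes G + j) = of_bool (index_adj G i j)"
proof -
  define vs n where "vs = sorted_list_of_set (verts G)" and "n = num_nodes G"
  define A where "A = concat (map (\<lambda>u. map (\<lambda>v. if {u, v} \<in> edges G then 1 else 0 :: nat) vs) vs)"
  have n: "length vs = n" unfolding vs_def n_def by (rule length_sorted_verts)
  have enc: "encode G = n # vs @ A" by (simp add: encode_def vs_def n_def A_def Let_def)
  show "mem (initial_state (encode G)) 0 = num_nodes G"
    by (simp add: initial_state_def enc n_def)
  assume ij: "i < num_nodes G" "j < num_nodes G"
  have len: "length A = n * n" by (simp add: A_def length_concat comp_def sum_list_triv n)
  \<comment> \<open>Row \<open>i\<close> ends within the matrix, so the address holds a genuine
    entry and not the default 0 beyond the input.\<close>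
  have "(i + 1) * n \<le> n * n" using ij by (intro mult_right_mono) (auto simp: n_def)
  then have "i * n + j < n * n" using ij by (simp add: n_def)
  then have "mem (initial_state (encode G)) (n + 1 + i * n + j) = A ! (i * n + j)"
    by (simp add: initial_state_def enc n len nth_append add.assoc)
  also have "\<dots> = of_bool (index_adj G i j)"
    using nth_concat_map_map[of i vs j vs "\<lambda>u v. if {u, v} \<in> edges G then 1 else 0 :: nat"] ij n
    by (simp add: A_def n_def index_adj_def vs_def)
  finally show "mem (initial_state (encode G)) (num_nodes G + 1 + i * num_nodes G + j)
    = of_bool (index_adj G i j)" by (simp add: n_def)
qed

lemma encode_hub_graph:
  "encode (hub_graph G) = target_size G # [0..<target_size G] @
     concat (map (\<lambda>i. map (\<lambda>j. of_bool (hub_adj G i j)) [0..<target_size G]) [0..<target_size G])"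
proof -
  have "sorted_list_of_set {..<target_size G} = [0..<target_size G]"
    by (metis atLeast0LessThan sorted_list_of_set_range)
  then show ?thesis
    by (auto simp: encode_def Let_def intro!: arg_cong[where f = concat])
qed

text \<open>The double sum is the value accumulated by \<open>count_prog\<close>.\<close>

lemma card_index_pairs:
  "card (index_pairs G) = (\<Sum>i<num_nodes G. \<Sum>j<num_nodes G. of_bool (index_adj G i j))"
proof -
  define n where "n = num_nodes G"
  have "index_pairs G = (SIGMA i:{..<n}. {j. j < n \<and> index_adj G i j})"
    by (auto simp: index_pairs_def n_def)
  then have "card (index_pairs G) = (\<Sum>i<n. card {j. j < n \<and> index_adj G i j})"
    by simp
  also have "\<dots> = (\<Sum>i<n. \<Sum>j<n. of_bool (index_adj G i j))"
    by (intro sum.cong refl) (simp add: sum.If_cases of_bool_def Int_def)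
  finally show ?thesis by (simp add: n_def)
qed

section \<open>The whole program and its polynomial bound\<close>

lemma runs_hub_prog:
  "runs hub_prog (initial_state (encode G))
     (\<lambda>t s. t \<le> 100 * (target_size G + 1) ^ 3 \<and> out s = encode (hub_graph G))"
proof -
  define n K N where "n = num_nodes G" and "K = loop_start G" and "N = target_size G"
  define m where "m = mem (initial_state (encode G))"
  define s0 where "s0 = (initial_state (encode G))\<lparr>reg := (\<lambda>_. 0)(0 := n, 6 := 1, 5 := n + 1)\<rparr>"
  have m0: "m 0 = n" and mA: "\<And>i j. i < n \<Longrightarrow> j < n \<Longrightarrow> m (n + 1 + i * n + j) = of_bool (index_adj G i j)"
    using mem_initial_state_encode[where G = G] by (simp_all add: m_def n_def)
  have reg_init: "reg (initial_state (encode G)) = (\<lambda>_. 0)"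
    by (simp add: initial_state_def)
  have s0: "reg s0 = (\<lambda>_. 0)(0 := n, 6 := 1, 5 := n + 1)" "mem s0 = m" "out s0 = []"
    by (simp_all add: s0_def m_def initial_state_def)
  have nK: "n + 3 \<le> K" "K \<le> N" "n < N" "n < K"
    using less_target_size[of G] target_size(2)[of G] by (auto simp: n_def K_def N_def)
  have sum: "(\<Sum>i<n. \<Sum>j<n. of_bool (index_adj G i j)) + 6 * n + 3 = K"
    by (simp add: K_def loop_start_def card_index_pairs n_def)
  have hub: "of_bool (hub_adj G i j) = (if i < n \<and> j < n then m (n + 1 + i * n + j)
      else if i = n \<or> j = n \<or> i = j \<and> K \<le> i then 1 else 0)" for i j
    using nK mA[of i j] by (auto simp: hub_adj_def Let_def n_def[symmetric] K_def[symmetric])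
  \<comment> \<open>The program is verified from its end: each suffix \<open>c1\<close> to
    \<open>c4\<close> gets a specification for all states that carry the needed registers, and the
    phase in front only has to establish these.\<close>
  define c1 where "c1 = Add 5 0 6 ;; Const 3 0 ;; print_rows"
  have 1: "runs c1 s (\<lambda>t s'. t \<le> N * (11 * N + 4) + 3 \<and> out s' = encode (hub_graph G))"
    if s: "reg s 0 = n" "reg s 1 = K" "reg s 2 = N" "reg s 6 = 1" "mem s = m" "out s = N # [0..<N]" for s
    unfolding c1_def runs_simps
    by (rule runs_mono, rule runs_print_rows[where n = n and K = K and N = N and q = "n + 1"
          and b = "\<lambda>i j. of_bool (hub_adj G i j)"])
      (use s nK in \<open>simp_all add: hub encode_hub_graph flip: N_def\<close>)
  define c2 where "c2 = Print 2 ;; Const 3 0 ;; print_verts ;; c1"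
  have 2: "runs c2 s (\<lambda>t s'. t \<le> N * (11 * N + 4) + 3 * N + 6 \<and> out s' = encode (hub_graph G))"
    if s: "reg s 0 = n" "reg s 1 = K" "reg s 2 = N" "reg s 6 = 1" "mem s = m" "out s = []" for s
    unfolding c2_def runs_simps
    by (rule runs_mono, rule runs_print_verts[where N = N], use s in \<open>simp_all add: frame_def\<close>)
      (rule runs_mono, rule 1, simp_all)
  define c3 where "c3 = Sub 2 1 6 ;; prime_search ;; c2"
  have P: "1 \<le> K - 1" "K - 1 < N" "prime N" "\<And>p. K - 1 < p \<Longrightarrow> p < N \<Longrightarrow> \<not> prime p"
    using nK target_size[of G] by (simp_all flip: N_def K_def)
  have 3: "runs c3 s (\<lambda>t s'. t \<le> N * (N * (2 * N + 6) + 5) + N * (11 * N + 4) + 3 * N + 8 \<and>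
      out s' = encode (hub_graph G))"
    if s: "reg s 0 = n" "reg s 1 = K" "reg s 6 = 1" "reg s 8 = 0" "mem s = m" "out s = []" for s
    unfolding c3_def runs_simps
    by (rule runs_mono, rule runs_prime_search[OF _ _ _ P], use s in \<open>simp_all add: frame_def\<close>)
      (rule runs_mono, rule 2, simp_all)
  define c4 where "c4 = Const 7 3 ;; Add 1 1 7 ;;
     Add 1 1 0 ;; Add 1 1 0 ;; Add 1 1 0 ;; Add 1 1 0 ;; Add 1 1 0 ;; Add 1 1 0 ;; c3"
  have 4: "runs c4 s (\<lambda>t s'. t \<le> N * (N * (2 * N + 6) + 5) + N * (11 * N + 4) + 3 * N + 16 \<and>
      out s' = encode (hub_graph G))"
    \<comment> \<open>At this point register 1 holds the number of adjacent pairs.\<close>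
    if s: "reg s 0 = n" "reg s 1 + 6 * n + 3 = K" "reg s 6 = 1" "reg s 8 = 0" "mem s = m" "out s = []" for s
    by (simp add: c4_def, rule runs_mono, rule 3) (use s in simp_all)
  have 5: "runs (count_prog ;; c4) s0 (\<lambda>t s'. t \<le> N * (N * (2 * N + 6) + 5) + N * (11 * N + 4) + 3 * N + 17
        + N * (5 * N + 4) \<and> out s' = encode (hub_graph G))"
    unfolding runs_simps
    by (rule runs_mono, rule runs_count_prog[where n = n and q = "n + 1" and
          a = "\<lambda>i j. of_bool (index_adj G i j)"], use mA in \<open>simp_all add: s0 frame_def\<close>)
      (rule runs_mono, rule 4, use sum nK mult_mono[of n N "5 * n + 4" "5 * N + 4"] in simp_all)
  define c5 where "c5 = count_prog ;; c4"
  have start: "runs (Load 0 10 ;; Const 6 1 ;; Add 5 0 6 ;; c5) (initial_state (encode G)) Q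
      \<longleftrightarrow> runs c5 s0 (\<lambda>t. Q (Suc (Suc (Suc t))))" for Q
    using m0 by (simp add: s0_def m_def reg_init)
  have prog: "hub_prog = Load 0 10 ;; Const 6 1 ;; Add 5 0 6 ;; c5"
    by (simp only: hub_prog_def c1_def c2_def c3_def c4_def c5_def)
  \<comment> \<open>Coefficientwise comparison; the leading term on the left is
    \<open>2 * N ^ 3\<close>, from the prime search.\<close>
  have "3 + (N * (N * (2 * N + 6) + 5) + N * (11 * N + 4) + 3 * N + 17 + N * (5 * N + 4))
      \<le> 100 * (N + 1) ^ 3"
    by (simp add: power3_eq_cube algebra_simps)
  then show ?thesis
    unfolding prog start N_def[symmetric]
    by - (rule runs_mono, rule 5[folded c5_def], linarith)
qed

lemma poly_time_computable_hub_graph: "poly_time_computable hub_graph"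
  unfolding poly_time_computable_def
\<comment> \<open>The polynomial is \<open>100 * (289 * (x + 1) ^ 4) ^ 3\<close>: cubic time in
  \<open>N + 1\<close>, where \<open>N\<close> is at most \<open>8 * K\<^sup>2\<close> and
  \<open>K\<close> is at most \<open>6 * (n + 1)\<^sup>2\<close>, so that \<open>N + 1\<close> is at
  most \<open>289 * (n + 1) ^ 4\<close>.\<close>
proof (intro exI[of _ hub_prog] exI[of _ "smult 100 ((smult 289 ([:1, 1:] ^ 4)) ^ 3)"] ballI)
  fix G :: "nat ugraph"
  assume "G \<in> Gamma0"
  define n N where "n = num_nodes G" and "N = target_size G"
  have K: "loop_start G \<le> 6 * (n + 1) ^ 2"
  proof -
    have "index_pairs G \<subseteq> {..<n} \<times> {..<n}" by (auto simp: index_pairs_def n_def)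
    then have "card (index_pairs G) \<le> card ({..<n} \<times> {..<n})" by (intro card_mono) auto
    then show ?thesis
      by (simp add: loop_start_def n_def[symmetric] power2_eq_square)
  qed
  have "N \<le> 8 * (loop_start G)\<^sup>2" unfolding N_def by (rule target_size(3))
  also have "\<dots> \<le> 8 * (6 * (n + 1) ^ 2)\<^sup>2"
    using K by (intro mult_left_mono power_mono) auto
  also have "\<dots> = 288 * (n + 1) ^ 4"
    by (simp add: power_mult_distrib flip: power_mult)
  also have "\<dots> + 1 \<le> 289 * (n + 1) ^ 4"
    by simp
  finally have "N + 1 \<le> 289 * (n + 1) ^ 4" by simp
  also have "\<dots> \<le> 289 * (graph_size G + 1) ^ 4"
    by (intro mult_left_mono power_mono) (auto simp: graph_size_def n_def)
  finally have "100 * (N + 1) ^ 3 \<le> 100 * (289 * (graph_size G + 1) ^ 4) ^ 3"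
    by (intro mult_left_mono power_mono) auto
  also have "\<dots> = poly (smult 100 ((smult 289 ([:1, 1:] ^ 4)) ^ 3)) (graph_size G)"
    by (simp add: poly_power)
  finally have le: "100 * (N + 1) ^ 3 \<le> poly (smult 100 ((smult 289 ([:1, 1:] ^ 4)) ^ 3)) (graph_size G)" .
  obtain t s where "exec hub_prog (initial_state (encode G)) t s" "out s = encode (hub_graph G)"
    "t \<le> 100 * (N + 1) ^ 3"
    using runs_hub_prog[of G] by (auto simp: runs_def N_def)
  with le show "\<exists>t s. exec hub_prog (initial_state (encode G)) t s \<and> out s = encode (hub_graph G) \<and>
    t \<le> poly (smult 100 ((smult 289 ([:1, 1:] ^ 4)) ^ 3)) (graph_size G)"
    by (meson le_trans)
qed

theorem theorem2:
  "\<exists>f :: nat ugraph \<Rightarrow> nat ugraph.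
     f \<in> Gamma0 \<rightarrow> class_G \<and>
     poly_time_computable f \<and>
     (\<forall>G1\<in>Gamma0. \<forall>G2\<in>Gamma0.
        connected_graph G1 \<longrightarrow> connected_graph G2 \<longrightarrow>
        num_nodes G1 = num_nodes G2 \<longrightarrow> num_edges G1 = num_edges G2 \<longrightarrow>
        (G1 \<simeq> G2 \<longleftrightarrow> f G1 \<simeq> f G2))"
proof (intro exI[of _ hub_graph] conjI ballI impI)
  show "hub_graph \<in> Gamma0 \<rightarrow> class_G" using hub_graph_in_class_G by auto
  show "poly_time_computable hub_graph" by (rule poly_time_computable_hub_graph)
next
  fix G1 G2 :: "nat ugraph"
  assume "G1 \<in> Gamma0" "G2 \<in> Gamma0" and c: "connected_graph G1"
    and n: "num_nodes G1 = num_nodes G2" and m: "num_edges G1 = num_edges G2"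
  then have u: "ugraph G1" "ugraph G2" by (auto simp: Gamma0_def)
  show "G1 \<simeq> G2 \<longleftrightarrow> hub_graph G1 \<simeq> hub_graph G2"
  proof
    assume "hub_graph G1 \<simeq> hub_graph G2"
    \<comment> \<open>Up to one vertex the edge counts decide; from two vertices on,
      \<open>G1\<close> is recovered from its hub graph.\<close>
    then show "G1 \<simeq> G2"
      using iso_of_num_nodes_le_1[OF u n m] iso_of_hub_graph_iso[OF u(1) c u(2) n[symmetric]]
      by linarith
  qed (rule hub_graph_iso[OF u])
qed

end
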